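(* Consider the 2-level MGProx iteration (steps (i)--(vi) in the context) for the problem $\min_x F_0(x)$, $F_0=f_0+g_0$, with an arbitrary coarse-correction stepsize $\alpha>0$ and an arbitrary choice of $\tau_{0\to1}^{k+1}$ in the set of step (iii). If $x_0^k$ is a minimizer of $F_0$, then $$x_0^{k+1}=y_0^{k+1}=x_0^k \qquad\text{and}\qquad x_1^{k+1}=y_1^{k+1}.$$
   Context: Problem: minimize $F_0(x)=f_0(x)+g_0(x)$ over $x\in\mathbb{R}^{n_0}$. Here $f_0:\mathbb{R}^{n_0}\to\mathbb{R}$ is $L_0$-smooth (differentiable with $L_0$-Lipschitz gradient) and $\mu_0$-strongly convex, $\mu_0>0$ (i.e. $f_0-\frac{\mu_0}{2}\|\cdot\|_2^2$ is convex); $g_0:\mathbb{R}^{n_0}\to\mathbb{R}$ is proper, convex, possibly nonsmooth and separable, $g_0(x)=\sum_i g_{0,i}(x_i)$, with a single point of nondifferentiability (each $g_{0,i}$ is nondifferentiable at at most one point). $\partial$ denotes the convex subdifferential. Coarse functions: let $n_1\le n_0$ and let $Q\in\mathbb{R}^{n_0\times n_1}$ have rank $n_1$. Put $f_1=f_0\circ Q$, $g_1=g_0\circ Q$, $F_1=f_1+g_1=F_0\circ Q:\mathbb{R}^{n_1}\to\mathbb{R}$. Adaptive restriction and prolongation: given a full restriction matrix $\overline{R}\in\mathbb{R}^{n_1\times n_0}$, for $y\in\mathbb{R}^{n_0}$ the adaptive restriction matrix $R(y)$ is obtained from $\overline{R}$ by setting to zero every column $i$ for which $\partial g_{0,i}(y_i)$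 is not a singleton. Thus $R(y)\,\partial F_0(y)$ is a singleton. The associated prolongation is $P=c\,R(y)^\top$ with a fixed constant $c>0$. Proximal operator: $\mathrm{prox}_{\beta g}(x)=\mathrm{argmin}_u\{\beta g(u)+\frac12\|u-x\|_2^2\}$. 2-level MGProx: given $x_0^k$, (i) $y_0^{k+1}=\mathrm{prox}_{\frac1{L_0}g_0}\big(x_0^k-\frac1{L_0}\nabla f_0(x_0^k)\big)$; (ii) $y_1^{k+1}=R(y_0^{k+1})\,y_0^{k+1}$; (iii) choose any $\tau_{0\to1}^{k+1}\in \partial F_1(y_1^{k+1})-R(y_0^{k+1})\,\partial F_0(y_0^{k+1})$; (iv) $x_1^{k+1}=\mathrm{argmin}_{\xi\in\mathbb{R}^{n_1}}\{F_1(\xi)-\langle\tau_{0\to1}^{k+1},\xi\rangle\}$; (v) $z_0^{k+1}=y_0^{k+1}+\alpha P(x_1^{k+1}-y_1^{k+1})$ with $P=c\,R(y_0^{k+1})^\top$ and $\alpha>0$ a stepsize; (vi) $x_0^{k+1}=\mathrm{prox}_{\frac1{L_0}g_0}\big(z_0^{k+1}-\frac1{L_0}\nabla f_0(z_0^{k+1})\big)$. *)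

theory Defs
  imports "HOL-Analysis.Analysis"
begin

definition gradient :: "('a::real_inner \<Rightarrow> real) \<Rightarrow> 'a \<Rightarrow> 'a" where
  "gradient f x = (THE D. GDERIV f x :> D)"

definition smooth_with :: "real \<Rightarrow> ('a::real_inner \<Rightarrow> real) \<Rightarrow> bool" where
  "smooth_with L f \<longleftrightarrow> f differentiable_on UNIV \<and> lipschitz_on L UNIV (gradient f)"

definition strongly_convex :: "real \<Rightarrow> ('a::real_inner \<Rightarrow> real) \<Rightarrow> bool" where
  "strongly_convex \<mu> f \<longleftrightarrow> convex_on UNIV (\<lambda>x. f x - \<mu> / 2 * (norm x)\<^sup>2)"

definition subdifferential :: "('a::real_inner \<Rightarrow> real) \<Rightarrow> 'a \<Rightarrow> 'a set" where
  "subdifferential f x = {v. \<forall>y. f y \<ge> f x + v \<bullet> (y - x)}"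

definition prox :: "real \<Rightarrow> ('a::real_inner \<Rightarrow> real) \<Rightarrow> 'a \<Rightarrow> 'a" where
  "prox \<beta> g x = (ARG_MIN (\<lambda>u. \<beta> * g u + 1 / 2 * (norm (u - x))\<^sup>2) u. True)"

(* Matrices are indexed row first, so i is the column index here. *)
definition adaptive_restriction ::
  "real^'n^'m \<Rightarrow> ('n \<Rightarrow> real \<Rightarrow> real) \<Rightarrow> real^'n \<Rightarrow> real^'n^'m" where
  "adaptive_restriction Rbar g y =
     (\<chi> j i. if is_singleton (subdifferential (g i) (y $ i)) then Rbar $ j $ i else 0)"

end

theory Submission
  imports Defs
begin

(* A minimizer x satisfies -grad f0(x) : subdifferential g0 (x), which is exactly the fixed-point
   equation of the proximal gradient step. Coordinatewise, every w in the subdifferential of F0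
   at x has w$i = 0 wherever the subdifferential of g i at x$i is a singleton; the restriction
   deletes the other coordinates, so R w = 0 and tau is itself a subgradient of F1 at y1. Hence
   y1 minimizes the coarse objective, uniquely since F1 is strictly convex (Q is injective), and
   the coarse correction vanishes. *)

text \<open>\<open>ARG_MIN\<close> is a Hilbert choice among minimizers, so its value is determined
  only where the minimum is strict.\<close>

lemma arg_min_eqI:
  fixes h :: "'a \<Rightarrow> real"
  assumes "\<And>u. u \<noteq> p \<Longrightarrow> h p < h u"
  shows "(ARG_MIN h u. True) = p"
  unfolding arg_min_def
proof (rule some_equality)
  show "is_arg_min h (\<lambda>u. True) p"
    using assms unfolding is_arg_min_def by (metis less_irrefl less_asym)
  show "q = p" if "is_arg_min h (\<lambda>u. True) q" for q
    using that assms unfolding is_arg_min_def by blast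
qed

lemma GDERIV_unique:
  fixes f :: "'a::real_inner \<Rightarrow> real"
  assumes "GDERIV f x :> D" and "GDERIV f x :> E"
  shows "D = E"
proof -
  have "(\<lambda>h. h \<bullet> D) = (\<lambda>h. h \<bullet> E)"
    using assms unfolding gderiv_def by (rule has_derivative_unique)
  then have "h \<bullet> D = h \<bullet> E" for h by (rule fun_cong)
  then show ?thesis using vector_eq_ldot[of D E] by simp
qed

text \<open>Riesz representation: the derivative \<open>f'\<close> is the inner product with
  \<open>adjoint f' 1\<close>. Uniqueness then resolves the \<open>THE\<close> in
  \<open>gradient\<close>.\<close>

lemma GDERIV_gradient:
  fixes f :: "'a::euclidean_space \<Rightarrow> real"
  assumes "f differentiable (at x)"
  shows "GDERIV f x :> gradient f x"
proof -
  obtain f' where f': "(f has_derivative f') (at x)"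
    using assms unfolding differentiable_def by blast
  then have lin: "linear f'" by (rule has_derivative_linear)
  have "f' = (\<lambda>h. h \<bullet> adjoint f' 1)"
    using adjoint_works[OF lin, of _ "1::real"] by (simp add: fun_eq_iff)
  with f' have ex: "GDERIV f x :> adjoint f' 1"
    unfolding gderiv_def by metis
  show ?thesis
    unfolding gradient_def using ex by (rule theI) (rule GDERIV_unique[OF _ ex])
qed

lemma smooth_with_GDERIV:
  fixes f :: "'a::euclidean_space \<Rightarrow> real"
  assumes "smooth_with L f"
  shows "GDERIV f x :> gradient f x"
  using assms unfolding smooth_with_def differentiable_on_def by (auto intro: GDERIV_gradient)

text \<open>Convexity of \<open>f\<close> minus the quadratic at weight 1/2, combined with the
  parallelogram law; the constant 1/8 is 1/2 times 1/4.\<close>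

lemma strongly_convex_midpoint:
  fixes f :: "'a::real_inner \<Rightarrow> real"
  assumes "strongly_convex \<mu> f"
  shows "f ((1/2) *\<^sub>R (a + b)) \<le> (f a + f b) / 2 - \<mu> / 8 * (norm (a - b))\<^sup>2"
proof -
  have "f ((1/2) *\<^sub>R (a + b)) - \<mu> / 2 * (norm ((1/2) *\<^sub>R (a + b)))\<^sup>2 \<le>
      1/2 * (f a - \<mu> / 2 * (norm a)\<^sup>2) + 1/2 * (f b - \<mu> / 2 * (norm b)\<^sup>2)"
    using convex_onD[OF assms[unfolded strongly_convex_def], of "1/2" a b]
    by (simp add: scaleR_right_distrib)
  then show ?thesis
    unfolding power2_norm_eq_inner
    by (simp add: inner_simps inner_commute[of b a] algebra_simps add_divide_distrib)
qed

(* lipschitz_on allows the constant 0, which would make the stepsize 1 / L equal to 0. *)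
lemma smooth_strongly_convex_pos:
  fixes f :: "'a::euclidean_space \<Rightarrow> real"
  assumes smooth: "smooth_with L f" and sc: "strongly_convex \<mu> f" and "\<mu> > 0"
  shows "L > 0"
proof (rule ccontr)
  assume "\<not> L > 0"
  moreover have lip: "lipschitz_on L UNIV (gradient f)"
    using smooth unfolding smooth_with_def by blast
  ultimately have L0: "L = 0"
    using lipschitz_on_nonneg by force
  define D where "D = gradient f 0"
  have "dist (gradient f x) (gradient f 0) \<le> L * dist x 0" for x
    using lip by (rule lipschitz_onD) auto
  then have const: "gradient f x = D" for x
    unfolding D_def L0 by simp
  \<comment> \<open>A constant gradient makes \<open>f\<close> affine. Affine functions satisfy the
    midpoint inequality with equality, which excludes the positive gap that strong convexity forces
    between 0 and a basis vector.\<close>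
  have "((\<lambda>x. f x - x \<bullet> D) has_derivative (\<lambda>h. 0)) (at x)" for x
    using has_derivative_diff[OF smooth_with_GDERIV[OF smooth, of x, unfolded const gderiv_def]
        has_derivative_inner_left[OF has_derivative_ident, of D]]
    by simp
  then obtain k where "f x - x \<bullet> D = k" for x
    using has_derivative_zero_constant[of UNIV "\<lambda>x. f x - x \<bullet> D"] by auto
  then have f_eq: "f x = x \<bullet> D + k" for x
    by (metis add.commute diff_add_cancel)
  obtain e :: 'a where e: "e \<in> Basis" by (rule nonempty_Basis[THEN ex_in_conv[THEN iffD2], THEN exE])
  have "\<mu> / 8 * (norm (e - 0))\<^sup>2 \<le> 0"
    using strongly_convex_midpoint[OF sc, of e 0] unfolding f_eq by (simp add: inner_simps add_divide_distrib)
  with e \<open>\<mu> > 0\<close> show False by simp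
qed

text \<open>The nontrivial half of the sum rule: restrict to the segment from \<open>x\<close> to
  \<open>y\<close>, divide the subgradient inequality by \<open>t\<close> and let \<open>t\<close>
  tend to 0 from the right.\<close>

lemma subdifferential_add_smooth:
  fixes f g :: "'a::real_inner \<Rightarrow> real"
  assumes g: "convex_on UNIV g" and D: "GDERIV f x :> D"
    and w: "w \<in> subdifferential (\<lambda>x. f x + g x) x"
  shows "w - D \<in> subdifferential g x"
  unfolding subdifferential_def
proof (intro CollectI allI)
  fix y
  let ?p = "\<lambda>t. x + t *\<^sub>R (y - x)"
  have "(?p has_derivative (\<lambda>t. t *\<^sub>R (y - x))) (at 0)"
    by (auto intro!: derivative_eq_intros)
  moreover have "(f has_derivative (\<lambda>h. h \<bullet> D)) (at (?p 0))"
    using D unfolding gderiv_def by simp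
  ultimately have "((\<lambda>t. f (?p t)) has_derivative (\<lambda>t. (t *\<^sub>R (y - x)) \<bullet> D)) (at 0)"
    by (rule has_derivative_compose)
  then have "((\<lambda>t. f (?p t)) has_real_derivative (y - x) \<bullet> D) (at 0)"
    by (rule has_derivative_imp_has_field_derivative) simp
  then have "((\<lambda>t. (f (?p t) - f x) / t) \<longlongrightarrow> (y - x) \<bullet> D) (at 0)"
    by (simp add: has_field_derivative_iff)
  then have lim: "((\<lambda>t. (f (?p t) - f x) / t) \<longlongrightarrow> (y - x) \<bullet> D) (at_right 0)"
    by (rule filterlim_mono) (simp_all add: at_le)
  \<comment> \<open>Convexity bounds the increment of \<open>g\<close> by
    \<open>t * (g y - g x)\<close>. After division by \<open>t\<close> only the difference quotient
    of \<open>f\<close> still depends on \<open>t\<close>.\<close>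
  have bound: "w \<bullet> (y - x) - (g y - g x) \<le> (f (?p t) - f x) / t" if t: "0 < t" "t < 1" for t
  proof -
    have "f x + g x + w \<bullet> (?p t - x) \<le> f (?p t) + g (?p t)"
      using w unfolding subdifferential_def by blast
    moreover have "?p t = (1 - t) *\<^sub>R x + t *\<^sub>R y"
      by (simp add: algebra_simps)
    then have "g (?p t) \<le> (1 - t) * g x + t * g y"
      using convex_onD[OF g, of t x y] t by simp
    ultimately have "t * (w \<bullet> (y - x) - (g y - g x)) \<le> f (?p t) - f x"
      by (simp add: algebra_simps)
    with t show ?thesis by (simp add: pos_le_divide_eq mult.commute)
  qed
  have "\<forall>\<^sub>F t in at_right (0::real). w \<bullet> (y - x) - (g y - g x) \<le> (f (?p t) - f x) / t"
    unfolding eventually_at_right_field using bound by (intro exI[of _ 1]) auto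
  then have "w \<bullet> (y - x) - (g y - g x) \<le> (y - x) \<bullet> D"
    using lim by (intro tendsto_lowerbound) auto
  then show "g x + (w - D) \<bullet> (y - x) \<le> g y"
    by (simp add: inner_diff_left inner_commute[of D])
qed

text \<open>At a point that differs from \<open>x\<close> in coordinate \<open>i\<close> only, all
  other summands cancel from the subgradient inequality.\<close>

lemma subdifferential_separable:
  fixes g :: "'n::finite \<Rightarrow> real \<Rightarrow> real"
  assumes "v \<in> subdifferential (\<lambda>x::real^'n. \<Sum>i\<in>UNIV. g i (x $ i)) x"
  shows "v $ i \<in> subdifferential (g i) (x $ i)"
  unfolding subdifferential_def
proof (intro CollectI allI)
  fix s
  let ?y = "x + axis i (s - x $ i)"
  have y: "?y $ j = (if j = i then s else x $ j)" for j
    by (simp add: axis_def)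
  have "(\<Sum>j\<in>UNIV. g j (x $ j)) + v \<bullet> (?y - x) \<le> (\<Sum>j\<in>UNIV. g j (?y $ j))"
    using assms unfolding subdifferential_def by blast
  moreover have "(\<Sum>j\<in>UNIV. g j (?y $ j)) = g i s + (\<Sum>j\<in>UNIV - {i}. g j (x $ j))"
    unfolding y by (subst sum.remove[of _ i]) (auto intro!: sum.cong)
  moreover have "(\<Sum>j\<in>UNIV. g j (x $ j)) = g i (x $ i) + (\<Sum>j\<in>UNIV - {i}. g j (x $ j))"
    by (subst sum.remove[of _ i]) auto
  ultimately show "g i (x $ i) + v $ i \<bullet> (s - x $ i) \<le> g i s"
    by (simp add: inner_axis)
qed

text \<open>The optimality condition of the prox problem, with the argument written as
  \<open>p + \<beta> *\<^sub>R v\<close> so that \<open>v = - gradient f p\<close> gives the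
  fixed-point equation of a proximal gradient step.\<close>

lemma prox_eqI:
  fixes g :: "'a::real_inner \<Rightarrow> real"
  assumes v: "v \<in> subdifferential g p" and "\<beta> \<ge> 0"
  shows "prox \<beta> g (p + \<beta> *\<^sub>R v) = p"
  unfolding prox_def
proof (rule arg_min_eqI)
  fix u assume "u \<noteq> p"
  have "\<beta> * (g p + v \<bullet> (u - p)) \<le> \<beta> * g u"
    using assms unfolding subdifferential_def by (intro mult_left_mono) auto
  \<comment> \<open>Expanding the square around \<open>p\<close> yields a linear term that cancels
    the one of the subgradient inequality. The remaining square of \<open>norm (u - p)\<close> makes
    the minimum strict.\<close>
  moreover have "(norm (u - (p + \<beta> *\<^sub>R v)))\<^sup>2 =
      (norm (u - p))\<^sup>2 - 2 * \<beta> * (v \<bullet> (u - p)) + (norm (p - (p + \<beta> *\<^sub>R v)))\<^sup>2"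
    unfolding power2_norm_eq_inner by (simp add: inner_simps inner_commute algebra_simps)
  moreover have "(norm (u - p))\<^sup>2 > 0"
    using \<open>u \<noteq> p\<close> by simp
  ultimately show "\<beta> * g p + 1 / 2 * (norm (p - (p + \<beta> *\<^sub>R v)))\<^sup>2
      < \<beta> * g u + 1 / 2 * (norm (u - (p + \<beta> *\<^sub>R v)))\<^sup>2"
    unfolding distrib_left by linarith
qed

theorem theorem2p4:
  fixes f0 g0 F0 :: "real^'n \<Rightarrow> real"
    and g :: "'n \<Rightarrow> real \<Rightarrow> real"
    and f1 g1 F1 :: "real^'m \<Rightarrow> real"
    and Q :: "real^'m^'n"
    and Rbar R :: "real^'n^'m"
    and P :: "real^'m^'n"
    and L0 \<mu>0 c \<alpha> :: real
    and x0 y0 z0 x0' :: "real^'n"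
    and y1 \<tau> x1 :: "real^'m"
  assumes f0_smooth: "smooth_with L0 f0"
    and \<mu>0_pos: "\<mu>0 > 0"
    and f0_strongly_convex: "strongly_convex \<mu>0 f0"
    and g0_convex: "convex_on UNIV g0"
    and g0_separable: "g0 = (\<lambda>x. \<Sum>i\<in>UNIV. g i (x $ i))"
    and g_nondiff: "\<And>i s t. \<not> (g i) differentiable (at s) \<Longrightarrow>
                            \<not> (g i) differentiable (at t) \<Longrightarrow> s = t"
    and F0: "F0 = (\<lambda>x. f0 x + g0 x)"
    and n1_le_n0: "CARD('m) \<le> CARD('n)"
    and rank_Q: "rank Q = CARD('m)"
    and f1: "f1 = (\<lambda>\<xi>. f0 (Q *v \<xi>))"
    and g1: "g1 = (\<lambda>\<xi>. g0 (Q *v \<xi>))"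
    and F1: "F1 = (\<lambda>\<xi>. f1 \<xi> + g1 \<xi>)"
    and c_pos: "c > 0"
    and \<alpha>_pos: "\<alpha> > 0"
    and step_i: "y0 = prox (1 / L0) g0 (x0 - (1 / L0) *\<^sub>R gradient f0 x0)"
    and R: "R = adaptive_restriction Rbar g y0"
    and step_ii: "y1 = R *v y0"
    and step_iii: "\<tau> \<in> {v - R *v w | v w. v \<in> subdifferential F1 y1 \<and> w \<in> subdifferential F0 y0}"
    and step_iv: "x1 = (ARG_MIN (\<lambda>\<xi>. F1 \<xi> - \<tau> \<bullet> \<xi>) \<xi>. True)"
    and P: "P = c *\<^sub>R transpose R"
    and step_v: "z0 = y0 + \<alpha> *\<^sub>R (P *v (x1 - y1))"
    and step_vi: "x0' = prox (1 / L0) g0 (z0 - (1 / L0) *\<^sub>R gradient f0 z0)"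
    and x0_minimizer: "is_arg_min F0 (\<lambda>_. True) x0"
  shows "x0' = y0 \<and> y0 = x0 \<and> x1 = y1"
proof -
  have L0: "L0 > 0"
    using f0_smooth f0_strongly_convex \<mu>0_pos by (rule smooth_strongly_convex_pos)
  have zero: "0 \<in> subdifferential F0 x0"
    using x0_minimizer unfolding is_arg_min_linorder subdifferential_def by simp
  have sub: "w - gradient f0 x0 \<in> subdifferential g0 x0" if "w \<in> subdifferential F0 x0" for w
    using g0_convex smooth_with_GDERIV[OF f0_smooth] that unfolding F0
    by (rule subdifferential_add_smooth)
  have prox_x0: "prox (1 / L0) g0 (x0 - (1 / L0) *\<^sub>R gradient f0 x0) = x0"
    using prox_eqI[OF sub[OF zero], of "1 / L0"] L0 by simp
  then have y0: "y0 = x0" using step_i by simp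
  have R0: "R *v w = 0" if w: "w \<in> subdifferential F0 x0" for w
  proof -
    have "R $ j $ i * w $ i = 0" for i j
    proof (cases "is_singleton (subdifferential (g i) (x0 $ i))")
      case True
      then obtain s where s: "subdifferential (g i) (x0 $ i) = {s}"
        by (rule is_singletonE)
      have "(u - gradient f0 x0) $ i = s" if "u \<in> subdifferential F0 x0" for u
        using subdifferential_separable[OF sub[OF that, unfolded g0_separable]] s by blast
      \<comment> \<open>Both \<open>w\<close> and 0 are subgradients of \<open>F0\<close> at
        \<open>x0\<close>; after the same shift by the gradient both have \<open>i\<close>-th
        coordinate \<open>s\<close>, hence \<open>w $ i = 0\<close>.\<close>
      from this[OF w] this[OF zero] show ?thesis by simp
    next
      case False
      then show ?thesis by (simp add: R y0 adaptive_restriction_def)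
    qed
    then show ?thesis by (simp only: matrix_vector_mult_def vec_eq_iff) simp
  qed
  have \<tau>: "\<tau> \<in> subdifferential F1 y1"
    using step_iii R0 unfolding y0 by auto
  have inj_Q: "inj ((*v) Q)"
    using rank_Q by (simp add: full_rank_injective)
  have "x1 = y1"
    unfolding step_iv
  proof (rule arg_min_eqI)
    fix u assume "u \<noteq> y1"
    \<comment> \<open>The subgradient inequality at \<open>u\<close> itself would give only a weak
      inequality. Applied at the midpoint and combined with strict midpoint convexity of
      \<open>F1\<close>, it becomes strict.\<close>
    let ?m = "(1/2) *\<^sub>R (u + y1)"
    have Qm: "Q *v ?m = (1/2) *\<^sub>R (Q *v u + Q *v y1)"
      by (simp add: matrix_vector_mult_scaleR matrix_vector_right_distrib)
    have "Q *v u \<noteq> Q *v y1"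
      using inj_Q \<open>u \<noteq> y1\<close> by (auto dest: injD)
    then have "0 < \<mu>0 / 8 * (norm (Q *v u - Q *v y1))\<^sup>2"
      using \<mu>0_pos by simp
    then have "f1 ?m < (f1 u + f1 y1) / 2"
      using strongly_convex_midpoint[OF f0_strongly_convex, of "Q *v u" "Q *v y1"]
      unfolding f1 Qm by linarith
    moreover have "g1 ?m \<le> (g1 u + g1 y1) / 2"
      using convex_onD[OF g0_convex, of "1/2" "Q *v u" "Q *v y1"]
      unfolding g1 Qm by (simp add: scaleR_right_distrib)
    ultimately have "F1 ?m < (F1 u + F1 y1) / 2"
      unfolding F1 by (simp add: add_divide_distrib)
    moreover have "F1 y1 + \<tau> \<bullet> (?m - y1) \<le> F1 ?m"
      using \<tau> unfolding subdifferential_def by blast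
    moreover have "\<tau> \<bullet> (?m - y1) = (\<tau> \<bullet> u - \<tau> \<bullet> y1) / 2"
      by (simp add: inner_simps)
    ultimately show "F1 y1 - \<tau> \<bullet> y1 < F1 u - \<tau> \<bullet> u"
      by argo
  qed
  \<comment> \<open>With a zero correction, step (vi) repeats step (i) at \<open>x0\<close>, so
    \<open>prox_x0\<close> applies again.\<close>
  moreover from this have "z0 = x0"
    using step_v y0 by simp
  ultimately show ?thesis
    using y0 prox_x0 step_vi by simp
qed

end
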